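(* For every pair $(A,B) \in \{(36,30), (72,42), (196,70), (252,114)\}$ and every integer $n \geq 0$, we have $\nu_2(An+B) \equiv 0 \pmod{4}$.
   Context: For a positive integer $m$ and $k \geq 1$, $\nu_k(m)$ denotes the number of partitions of $m$ in which exactly $k$ distinct part sizes appear (e.g. $\nu_2(5)=5$, counting $4+1$, $3+2$, $3+1+1$, $2+2+1$, $2+1+1+1$). *)

theory Defs
  imports "HOL-Library.Multiset" "HOL-Number_Theory.Cong"
begin

text \<open>A partition of \<open>m\<close> is the multiset of its parts, which are positive.\<close>

definition partitions :: "nat \<Rightarrow> nat multiset set" where
  "partitions m = {P. 0 \<notin># P \<and> sum_mset P = m}"

definition nu :: "nat \<Rightarrow> nat \<Rightarrow> nat" where
  "nu k m = card {P \<in> partitions m. card (set_mset P) = k}"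

text \<open>Finiteness ensures that the cardinality in \<open>nu\<close> is a genuine count.\<close>

lemma size_le_sum_mset: "0 \<notin># P \<Longrightarrow> size P \<le> sum_mset (P :: nat multiset)"
  by (induction P) auto

lemma finite_partitions: "finite (partitions m)"
proof -
  have "partitions m \<subseteq> mset ` {xs. set xs \<subseteq> {..m} \<and> length xs \<le> m}"
  proof
    fix P assume "P \<in> partitions m"
    then have P: "0 \<notin># P" "sum_mset P = m" by (auto simp: partitions_def)
    obtain xs where xs: "mset xs = P" using ex_mset by blast
    have "length xs \<le> m" using size_le_sum_mset[OF P(1)] P(2) xs by auto
    moreover have "set xs \<subseteq> {..m}"
      using P(2) xs by (auto simp: sum_mset_sum_list member_le_sum_list)
    ultimately show "P \<in> mset ` {xs. set xs \<subseteq> {..m} \<and> length xs \<le> m}"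
      using xs by blast
  qed
  moreover have "finite {xs. set xs \<subseteq> {..m} \<and> length xs \<le> m}"
    by (rule finite_lists_length_le) simp
  ultimately show ?thesis by (meson finite_imageI finite_subset)
qed

end

theory Submission
  imports Defs "HOL-Computational_Algebra.Nth_Powers" "HOL-Number_Theory.Residues"
begin

text \<open>
  Write \<open>d\<close> and \<open>\<sigma>\<close> for the number and the sum of the divisors. Counting the solutions of
  \<open>a x + b y = n\<close> gives \<open>2 \<nu>\<^sub>2(n) = (\<Sum>k. d(k) d(n - k)) - \<sigma>(n) + d(n)\<close>. In all four progressions
  \<open>n = 2 q M\<close> with a prime \<open>q \<equiv> 3 (mod 4)\<close> not dividing the odd nonsquare \<open>M\<close>. Then \<open>8\<close> divides
  \<open>d(n)\<close> and \<open>\<sigma>(n)\<close>, and \<open>n\<close> is not a sum of two squares. Since \<open>d(k)\<close> is odd only for squares,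
  the convolution is \<open>2 (\<Sum>a. d(n - a\<^sup>2))\<close> modulo \<open>8\<close>, so the sum over \<open>a\<close> has to vanish
  modulo \<open>4\<close>. Let \<open>R\<close> count the positive solutions of \<open>2 a\<^sup>2 + 4 c\<^sup>2 = n\<close>. The even \<open>a\<close>
  contribute \<open>2 R\<close>, because \<open>d(n - a\<^sup>2) = 2 d((n - a\<^sup>2) / 2)\<close>. For odd \<open>a\<close>, Zagier's involution
  gives \<open>d(m) \<equiv> 2 #{(b, c). b\<^sup>2 + 4 c\<^sup>2 = m} (mod 4)\<close> for \<open>m = n - a\<^sup>2\<close>, and the symmetry between
  \<open>a\<close> and \<open>b\<close> in \<open>a\<^sup>2 + b\<^sup>2 + 4 c\<^sup>2 = n\<close> leaves \<open>2 R\<close> once more.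
\<close>

section \<open>Involutions\<close>

text \<open>The points that \<open>f\<close> moves fall into pairs \<open>{x, f x}\<close>; the
  induction removes one pair at a time until only fixed points are left.\<close>

lemma even_card_involution_iff:
  assumes "finite A" and "\<And>x. x \<in> A \<Longrightarrow> f x \<in> A" and "\<And>x. x \<in> A \<Longrightarrow> f (f x) = x"
  shows "even (card A) \<longleftrightarrow> even (card {x \<in> A. f x = x})"
  using assms
proof (induction A rule: finite_psubset_induct)
  case (psubset A)
  show ?case
  proof (cases "\<forall>x\<in>A. f x = x")
    case True
    then have "{x \<in> A. f x = x} = A" by auto
    then show ?thesis by simp
  next
    case False
    then obtain x where x: "x \<in> A" "f x \<noteq> x" by blast
    let ?B = "A - {x, f x}"
    have fx: "f x \<in> A" "f (f x) = x" using x psubset.prems by auto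
    have "even (card ?B) \<longleftrightarrow> even (card {y \<in> ?B. f y = y})"
    proof (rule psubset.IH)
      show "?B \<subset> A" using x by auto
      show "f y \<in> ?B" if "y \<in> ?B" for y
        using that psubset.prems fx by (metis Diff_iff insert_iff singletonD)
      show "f (f y) = y" if "y \<in> ?B" for y using that psubset.prems by auto
    qed
    moreover have "{y \<in> ?B. f y = y} = {y \<in> A. f y = y}" using x fx by auto
    moreover have "card A = card ?B + 2"
    proof -
      have "card {x, f x} = 2" using x by simp
      moreover have "card ?B = card A - card {x, f x}"
        using x fx psubset.hyps by (intro card_Diff_subset) auto
      moreover have "card {x, f x} \<le> card A"
        using x fx psubset.hyps by (intro card_mono) auto
      ultimately show ?thesis by linarith
    qed
    ultimately show ?thesis by simp
  qed
qed

lemma cong_double_mod_4: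
  fixes x y :: nat
  assumes "even x \<longleftrightarrow> even y"
  shows "[2 * x = 2 * y] (mod 4)"
proof -
  have "x mod 2 = y mod 2" using assms by (simp add: mod2_eq_if)
  then show ?thesis using mod_mult_mult1[of 2 x 2] mod_mult_mult1[of 2 y 2] by (simp add: cong_def)
qed

section \<open>Divisor functions\<close>

definition divisor_count :: "nat \<Rightarrow> nat" where
  "divisor_count n = card {d. d dvd n}"

definition divisor_sum :: "nat \<Rightarrow> nat" where
  "divisor_sum n = (\<Sum>d | d dvd n. d)"

text \<open>A divisor of \<open>p * n\<close> that is not a multiple of \<open>p\<close> is coprime
  to \<open>p\<close> and hence divides \<open>n\<close>. The two sets may overlap here; they are
  disjoint once \<open>p\<close> does not divide \<open>n\<close>.\<close>

lemma divisors_prime_mult: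
  fixes p n :: nat
  assumes "prime p"
  shows "{d. d dvd p * n} = {d. d dvd n} \<union> (*) p ` {d. d dvd n}"
proof (intro equalityI subsetI)
  fix d assume "d \<in> {d. d dvd p * n}"
  then have d: "d dvd p * n" by simp
  show "d \<in> {d. d dvd n} \<union> (*) p ` {d. d dvd n}"
  proof (cases "p dvd d")
    case True
    then obtain e where "d = p * e" by auto
    moreover have "p > 0" using assms prime_gt_0_nat by blast
    ultimately show ?thesis using d by auto
  next
    case False
    then have "coprime d p" using assms prime_imp_coprime coprime_commute by blast
    then show ?thesis using d by (simp add: coprime_dvd_mult_right_iff)
  qed
qed auto

lemma
  fixes p n :: nat
  assumes "prime p" "\<not> p dvd n"
  shows divisor_count_prime_mult: "divisor_count (p * n) = 2 * divisor_count n"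
    and divisor_sum_prime_mult: "divisor_sum (p * n) = (p + 1) * divisor_sum n"
proof -
  have p: "p > 0" using assms prime_gt_0_nat by blast
  have fin: "finite {d. d dvd n}" using assms by (cases "n = 0") auto
  have disj: "{d. d dvd n} \<inter> (*) p ` {d. d dvd n} = {}"
    using assms by (auto dest: dvd_mult_left)
  have inj: "inj_on ((*) p) {d. d dvd n}" using p by (auto simp: inj_on_def)
  show "divisor_count (p * n) = 2 * divisor_count n"
    unfolding divisor_count_def divisors_prime_mult[OF assms(1)]
    using fin disj inj by (simp add: card_Un_disjoint card_image)
  show "divisor_sum (p * n) = (p + 1) * divisor_sum n"
    unfolding divisor_sum_def divisors_prime_mult[OF assms(1)]
    using fin disj inj by (simp add: sum.union_disjoint sum.reindex sum_distrib_left sum.distrib)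
qed

text \<open>The involution sending \<open>d\<close> to \<open>m div d\<close> fixes only a square
  root of \<open>m\<close>.\<close>

lemma even_divisor_count_iff:
  assumes "m > 0"
  shows "even (divisor_count m) \<longleftrightarrow> \<not> is_square m"
proof -
  have "even (card {d. d dvd m}) \<longleftrightarrow> even (card {d \<in> {d. d dvd m}. m div d = d})"
    by (rule even_card_involution_iff) (use assms in auto)
  also have "{d \<in> {d. d dvd m}. m div d = d} = {d. d ^ 2 = m}"
    using assms by (auto simp: power2_eq_square)
  also have "even (card {d. d ^ 2 = m}) \<longleftrightarrow> \<not> is_square m"
  proof (cases "is_square m")
    case True
    then obtain a where "m = a ^ 2" by (auto elim: is_nth_powerE)
    then have "{d. d ^ 2 = m} = {a}" by (auto simp: power2_eq_iff_nonneg)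
    then show ?thesis using True by simp
  next
    case False
    then have "{d. d ^ 2 = m} = {}" by (auto intro: is_nth_powerI)
    then show ?thesis using False by simp
  qed
  finally show ?thesis by (simp add: divisor_count_def)
qed

text \<open>All divisors of an odd number are odd, so their sum has the parity of their
  number.\<close>

lemma even_divisor_sum:
  assumes "odd m" "\<not> is_square m"
  shows "even (divisor_sum m)"
proof -
  have m: "m > 0" using assms by (cases m) auto
  have "even (\<Sum>d | d dvd m. d) \<longleftrightarrow> even (\<Sum>d | d dvd m. 1::nat)"
  proof -
    have "(\<Sum>d | d dvd m. d) + (\<Sum>d | d dvd m. 1) = (\<Sum>d | d dvd m. d + 1)"
      by (simp only: sum.distrib)
    moreover have "even (\<Sum>d | d dvd m. d + 1)"
      using assms(1) by (intro dvd_sum) (auto dest: dvd_trans)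
    ultimately show ?thesis by (metis even_add)
  qed
  then show ?thesis
    using even_divisor_count_iff[OF m] assms(2) by (simp add: divisor_sum_def divisor_count_def)
qed

text \<open>Complementary divisors lie on opposite sides of the square root of \<open>m\<close>. The
  exact factor 2, rather than mere evenness, is what \<open>card_zagier_fixed\<close> needs.\<close>

lemma divisor_count_nonsquare:
  assumes "m > 0" "\<not> is_square m"
  shows "divisor_count m = 2 * card {d. d dvd m \<and> d * d < m}"
proof -
  let ?L = "{d. d dvd m \<and> d * d < m}" and ?G = "{d. d dvd m \<and> d * d > m}"
  have fin: "finite {d. d dvd m}" using assms by simp
  have "d * d \<noteq> m" for d
    using assms by (auto simp flip: power2_eq_square)
  then have "{d. d dvd m} = ?L \<union> ?G" by (auto simp: neq_iff)
  moreover have "card (?L \<union> ?G) = card ?L + card ?G"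
    by (rule card_Un_disjoint) (auto intro: finite_subset[OF _ fin])
  moreover have "card ?L = card ?G"
  proof (rule bij_betw_same_card)
    have *: "(m div d) * (m div d) > m \<longleftrightarrow> d * d < m" "(m div d) * (m div d) < m \<longleftrightarrow> d * d > m"
      if dvd: "d dvd m" for d
    proof -
      obtain e where e: "m = d * e" using dvd by auto
      then have "d > 0" "e > 0" using assms by auto
      then show "(m div d) * (m div d) > m \<longleftrightarrow> d * d < m" "(m div d) * (m div d) < m \<longleftrightarrow> d * d > m"
        using e by auto
    qed
    show "bij_betw (\<lambda>d. m div d) ?L ?G"
      by (rule bij_betw_byWitness[where f' = "\<lambda>d. m div d"]) (use assms * in auto)
  qed
  ultimately have "card {d. d dvd m} = card ?L + card ?L" by (simp only:)
  then show ?thesis by (simp only: divisor_count_def mult_2)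
qed

section \<open>Zagier's involution\<close>

text \<open>The set from Zagier's one-sentence proof of the two-square theorem, where
  \<open>m\<close> is a prime; here \<open>m\<close> is arbitrary.\<close>

definition zagier_set :: "nat \<Rightarrow> (nat \<times> nat \<times> nat) set" where
  "zagier_set m = {(x, y, z). 0 < x \<and> 0 < y \<and> 0 < z \<and> x * x + 4 * y * z = m}"

text \<open>No subtraction is truncated in the branch that uses it. On the boundaries
  \<open>y = x + z\<close> and \<open>x = 2 * y\<close>, an entry of the image is 0.\<close>

fun zagier_map :: "nat \<times> nat \<times> nat \<Rightarrow> nat \<times> nat \<times> nat" where
  "zagier_map (x, y, z) =
    (if x + z < y then (x + 2 * z, z, y - x - z)
     else if x < 2 * y then (2 * y - x, y, x + z - y)
     else (x - 2 * y, x + z - y, y))"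

lemma finite_zagier_set: "finite (zagier_set m)"
proof (rule finite_subset)
  show "zagier_set m \<subseteq> {..m} \<times> {..m} \<times> {..m}"
  proof (clarsimp simp: zagier_set_def)
    fix x y z :: nat assume "0 < x" "0 < y" "0 < z"
    then have "x \<le> x * x" "y \<le> y * z" "z \<le> y * z" by auto
    then show "x \<le> x * x + 4 * y * z \<and> y \<le> x * x + 4 * y * z \<and> z \<le> x * x + 4 * y * z"
      by linarith
  qed
qed auto

text \<open>The first and the third branch are inverse to each other, and the middle one maps its
  region to itself. A fixed point therefore lies in the middle region, where
  \<open>2 * y - x = x\<close> means \<open>x = y\<close>. The hypotheses on \<open>m\<close>
  exclude the boundaries: \<open>y = x + z\<close> makes \<open>m\<close> a square, and
  \<open>x = 2 * y\<close> makes it even.\<close>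

lemma zagier_map_involution:
  assumes m: "odd m" "\<not> is_square m" and t: "t \<in> zagier_set m"
  shows "zagier_map t \<in> zagier_set m" and "zagier_map (zagier_map t) = t"
    and "zagier_map t = t \<longleftrightarrow> fst t = fst (snd t)"
proof -
  obtain x y z where t_eq: "t = (x, y, z)" by (cases t)
  have pos: "0 < x" "0 < y" "0 < z" and eq: "x * x + 4 * y * z = m"
    using t by (auto simp: t_eq zagier_set_def)
  have ne1: "y \<noteq> x + z"
  proof
    assume "y = x + z"
    then have "m = (y + z) ^ 2" using eq by (simp add: power2_eq_square algebra_simps)
    then show False using m(2) by (auto intro: is_nth_powerI)
  qed
  have ne2: "x \<noteq> 2 * y" using eq m(1) by auto
  consider "x + z < y" | "y < x + z" "x < 2 * y" | "2 * y < x" using ne1 ne2 by linarith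
  then have "zagier_map t \<in> zagier_set m \<and> zagier_map (zagier_map t) = t \<and>
    (zagier_map t = t \<longleftrightarrow> x = y)"
  proof cases
    case 1
    then obtain v where v: "y = x + z + v" "v > 0" by (metis less_imp_add_positive)
    have "(x + 2 * z) * (x + 2 * z) + 4 * z * v = m"
      using eq v by (simp add: algebra_simps)
    then show ?thesis using 1 pos v by (auto simp: t_eq zagier_set_def)
  next
    case 2
    then obtain u v where u: "2 * y = x + u" "u > 0" and v: "x + z = y + v" "v > 0"
      by (metis less_imp_add_positive)
    \<comment> \<open>Over the integers \<open>u\<close> and \<open>v\<close> can be replaced by
      differences without truncation.\<close>
    have "int u * int u + 4 * int y * int v = int x * int x + 4 * int y * int z"
    proof -
      have uv: "int u = 2 * int y - int x" "int v = int x + int z - int y" using u v by linarith+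
      show ?thesis unfolding uv by (simp add: algebra_simps)
    qed
    then have "int (u * u + 4 * y * v) = int (x * x + 4 * y * z)" by simp
    then have "u * u + 4 * y * v = m" by (simp only: of_nat_eq_iff eq)
    moreover have "zagier_map t = (u, y, v)" using 2 u v by (simp add: t_eq)
    moreover have "zagier_map (u, y, v) = t" using 2 u v pos by (auto simp: t_eq)
    ultimately show ?thesis using u v pos by (auto simp: t_eq zagier_set_def)
  next
    case 3
    then obtain u where u: "x = 2 * y + u" "u > 0" by (metis less_imp_add_positive)
    have "u * u + 4 * (u + y + z) * y = m" using eq u by (simp add: algebra_simps)
    moreover have "zagier_map t = (u, u + y + z, y)" using u by (simp add: t_eq)
    moreover have "zagier_map (u, u + y + z, y) = t" using u pos by (auto simp: t_eq)
    ultimately show ?thesis using u pos by (auto simp: t_eq zagier_set_def)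
  qed
  then show "zagier_map t \<in> zagier_set m" "zagier_map (zagier_map t) = t"
    "zagier_map t = t \<longleftrightarrow> fst t = fst (snd t)"
    by (auto simp: t_eq)
qed

text \<open>A fixed point \<open>(d, d, z)\<close> is a factorization
  \<open>m = d * (d + 4 * z)\<close>, that is, a divisor \<open>d\<close> below the square root of
  \<open>m\<close>. Every such divisor occurs, since a product that is 1 modulo 4 has factors
  congruent modulo 4.\<close>

lemma card_zagier_fixed:
  assumes "m mod 4 = 1" "\<not> is_square m"
  shows "divisor_count m = 2 * card {t \<in> zagier_set m. fst t = fst (snd t)}"
proof -
  have m: "m > 0" using assms(1) by (cases m) auto
  let ?F = "{t \<in> zagier_set m. fst t = fst (snd t)}"
  have inj: "inj_on fst ?F" by (auto simp: inj_on_def zagier_set_def)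
  have img: "fst ` ?F = {d. d dvd m \<and> d * d < m}"
  proof (intro equalityI subsetI)
    fix d assume "d \<in> fst ` ?F"
    then obtain z where z: "0 < d" "0 < z" "d * d + 4 * d * z = m"
      by (auto simp: zagier_set_def)
    then have "m = d * (d + 4 * z)" by (simp add: algebra_simps)
    then show "d \<in> {d. d dvd m \<and> d * d < m}" using z by auto
  next
    fix d assume "d \<in> {d. d dvd m \<and> d * d < m}"
    then obtain e where e: "m = d * e" "d * d < d * e" by auto
    then have d: "d < e" "d > 0" by auto
    have "(d mod 4) * (e mod 4) mod 4 = 1" using e assms(1) by (simp add: mod_mult_eq)
    moreover have "d mod 4 \<in> {0,1,2,3}" "e mod 4 \<in> {0,1,2,3}" by auto
    ultimately have "e mod 4 = d mod 4" by auto
    then have "4 dvd e - d" using d by (simp add: mod_eq_dvd_iff_nat)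
    then obtain z where z: "e = d + 4 * z" using d by (metis dvdE le_add_diff_inverse less_imp_le)
    then have "(d, d, z) \<in> ?F" using d e by (auto simp: zagier_set_def algebra_simps)
    then show "d \<in> fst ` ?F" by (rule rev_image_eqI) simp
  qed
  have "card ?F = card {d. d dvd m \<and> d * d < m}"
    using card_image[OF inj] unfolding img by (rule sym)
  then show ?thesis using divisor_count_nonsquare[OF m assms(2)] by simp
qed

text \<open>Interchanging \<open>y\<close> and \<open>z\<close> is a second involution of the same set, with fixed points
  the representations of \<open>m\<close> by \<open>b\<^sup>2 + 4 c\<^sup>2\<close>.\<close>

lemma divisor_count_cong_two_squares:
  assumes "m mod 4 = 1" "\<not> is_square m"
  shows "[divisor_count m = 2 * card {(b, c). 0 < b \<and> 0 < c \<and> b^2 + 4 * c^2 = m}] (mod 4)"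
proof -
  let ?P = "{(b, c). 0 < b \<and> 0 < c \<and> b^2 + 4 * c^2 = m}"
  let ?F = "{t \<in> zagier_set m. fst t = fst (snd t)}"
  have odd: "odd m" using assms(1) by presburger
  have "even (card (zagier_set m)) \<longleftrightarrow> even (card {t \<in> zagier_set m. zagier_map t = t})"
    using zagier_map_involution[OF odd assms(2)] finite_zagier_set
    by (intro even_card_involution_iff) auto
  moreover have "{t \<in> zagier_set m. zagier_map t = t} = ?F"
    using zagier_map_involution(3)[OF odd assms(2)] by auto
  moreover have "even (card (zagier_set m)) \<longleftrightarrow>
    even (card {t \<in> zagier_set m. (\<lambda>(x, y, z). (x, z, y)) t = t})"
    by (rule even_card_involution_iff[OF finite_zagier_set])
      (auto simp: zagier_set_def algebra_simps)
  moreover have "card {t \<in> zagier_set m. (\<lambda>(x, y, z). (x, z, y)) t = t} = card ?P"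
  proof -
    have "{t \<in> zagier_set m. (\<lambda>(x, y, z). (x, z, y)) t = t} = (\<lambda>(b, c). (b, c, c)) ` ?P"
      by (force simp: zagier_set_def power2_eq_square)
    moreover have "inj_on (\<lambda>(b, c). (b, c, c)) ?P" by (auto simp: inj_on_def)
    ultimately show ?thesis by (simp only: card_image)
  qed
  \<comment> \<open>Both fixed-point counts have the parity of
    \<open>card (zagier_set m)\<close>.\<close>
  ultimately have "even (card ?F) \<longleftrightarrow> even (card ?P)" by simp
  then have "[2 * card ?F = 2 * card ?P] (mod 4)" by (rule cong_double_mod_4)
  then show ?thesis using card_zagier_fixed[OF assms] by simp
qed

section \<open>The divisor count at the numbers \<open>n - a\<^sup>2\<close>\<close>

lemma sum_divisor_count_odd:
  fixes n :: nat
  assumes n: "n mod 4 = 2" and nsq: "\<And>a b. n \<noteq> a^2 + b^2"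
  shows "[(\<Sum>a | odd a \<and> a^2 < n. divisor_count (n - a^2)) =
    2 * card {(a, c). 0 < a \<and> 0 < c \<and> 2 * a^2 + 4 * c^2 = n}] (mod 4)"
proof -
  let ?O = "{a. odd a \<and> a^2 < n}"
  let ?P = "\<lambda>m::nat. {(b, c). 0 < b \<and> 0 < c \<and> b^2 + 4 * c^2 = m}"
  let ?E = "{(a, b, c). odd a \<and> 0 < b \<and> 0 < c \<and> a^2 + b^2 + 4 * c^2 = n}"
  let ?R = "{(a, c). 0 < a \<and> 0 < c \<and> 2 * a^2 + 4 * c^2 = n}"
  have le_sq: "a \<le> a^2" for a :: nat by (simp add: power2_eq_square)
  have finO: "finite ?O"
    by (rule finite_subset[of _ "{..n}"]) (auto intro: order_trans[OF le_sq])
  have finP: "finite (?P m)" for m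
  proof (rule finite_subset)
    show "?P m \<subseteq> {..m} \<times> {..m}"
    proof clarsimp
      fix b c :: nat
      show "b \<le> b^2 + 4 * c^2 \<and> c \<le> b^2 + 4 * c^2" using le_sq[of b] le_sq[of c] by linarith
    qed
  qed auto
  have odd_sq: "a^2 mod 4 = (if odd a then 1 else 0)" for a :: nat
  proof -
    have "a mod 4 \<in> {0,1,2,3}" by auto
    moreover have "a^2 mod 4 = (a mod 4)^2 mod 4" by (simp add: power_mod)
    moreover have "odd a \<longleftrightarrow> odd (a mod 4)" by presburger
    ultimately show ?thesis by auto
  qed
  have diff_mod_4: "(j - k) mod 4 = 1" if "j mod 4 = 2" "k mod 4 = 1" "k < j" for j k :: nat
  proof -
    have "j = 4 * (j div 4) + 2" "k = 4 * (k div 4) + 1" using that(1,2) by (metis mult_div_mod_eq)+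
    then have "j - k = 4 * (j div 4 - k div 4) + 1" using that(3) by linarith
    then show ?thesis by simp
  qed
  have "[(\<Sum>a\<in>?O. divisor_count (n - a^2)) = (\<Sum>a\<in>?O. 2 * card (?P (n - a^2)))] (mod 4)"
  proof (intro cong_sum divisor_count_cong_two_squares)
    fix a assume a: "a \<in> ?O"
    then show "(n - a^2) mod 4 = 1" using n odd_sq[of a] diff_mod_4[of n "a^2"] by simp
    show "\<not> is_square (n - a^2)"
    proof
      assume "is_square (n - a^2)"
      then obtain b where "n - a^2 = b^2" by (auto elim: is_nth_powerE)
      moreover have "a^2 < n" using a by simp
      ultimately have "n = a^2 + b^2" by linarith
      then show False using nsq by blast
    qed
  qed
  also have "(\<Sum>a\<in>?O. 2 * card (?P (n - a^2))) = 2 * card (SIGMA a:?O. ?P (n - a^2))"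
    using finO finP by (simp add: card_SigmaI sum_distrib_left)
  also have "(SIGMA a:?O. ?P (n - a^2)) = ?E"
    by (auto simp: algebra_simps)
  also have "[2 * card ?E = 2 * card ?R] (mod 4)"
  proof -
    have finE: "finite ?E"
      using finite_SigmaI[of ?O "\<lambda>a. ?P (n - a^2)"] finO finP
        \<open>(SIGMA a:?O. ?P (n - a^2)) = ?E\<close> by metis
    \<comment> \<open>Since \<open>n\<close> is 2 modulo 4, an odd \<open>a\<close> forces an odd
      \<open>b\<close>, so interchanging \<open>a\<close> and \<open>b\<close> preserves
      \<open>?E\<close>.\<close>
    have b: "odd b" if "odd a" "a^2 + b^2 + 4 * c^2 = n" for a b c
    proof
      assume "even b"
      then have sq: "a^2 mod 4 = 1" "b^2 mod 4 = 0"
        using odd_sq[of a] odd_sq[of b] \<open>odd a\<close> by simp_all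
      have "(a^2 + b^2) mod 4 = (a^2 + b^2 + 4 * c^2) mod 4" by (rule mod_mult_self2[symmetric])
      then have "(a^2 + b^2) mod 4 = 2" by (simp only: that(2) n)
      then have "(a^2 mod 4 + b^2 mod 4) mod 4 = 2" by (simp only: mod_add_eq)
      then show False unfolding sq by simp
    qed
    have "even (card ?E) \<longleftrightarrow> even (card {t \<in> ?E. (\<lambda>(a, b, c). (b, a, c)) t = t})"
    proof (rule even_card_involution_iff[OF finE])
      fix t assume "t \<in> ?E"
      then obtain a b c where t: "t = (a, b, c)" "odd a" "0 < c" "a^2 + b^2 + 4 * c^2 = n" by auto
      then show "(\<lambda>(a, b, c). (b, a, c)) t \<in> ?E" using b[of a b c] by (simp add: odd_pos add.commute)
    qed auto
    also have "card {t \<in> ?E. (\<lambda>(a, b, c). (b, a, c)) t = t} = card ?R"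
    proof -
      \<comment> \<open>\<open>?R\<close> carries no parity condition, so oddness of
        \<open>a\<close> must follow from the equation: an even \<open>a\<close> would give 4
        dividing \<open>n\<close>.\<close>
      have odd: "odd a" if eq: "2 * a^2 + 4 * c^2 = n" for a c
      proof
        assume "even a"
        then have "4 dvd a^2" using odd_sq[of a] by (simp add: mod_eq_0_iff_dvd)
        then have "4 dvd n" unfolding eq[symmetric] by simp
        then show False using n by simp
      qed
      have "{t \<in> ?E. (\<lambda>(a, b, c). (b, a, c)) t = t} = (\<lambda>(a, c). (a, a, c)) ` ?R"
      proof (intro equalityI subsetI)
        fix t assume "t \<in> {t \<in> ?E. (\<lambda>(a, b, c). (b, a, c)) t = t}"
        then obtain a c where t: "t = (a, a, c)" "0 < a" "0 < c" "a^2 + a^2 + 4 * c^2 = n" by auto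
        then have "(a, c) \<in> ?R" by simp
        then show "t \<in> (\<lambda>(a, c). (a, a, c)) ` ?R" by (rule rev_image_eqI) (simp add: t(1))
      next
        fix t assume "t \<in> (\<lambda>(a, c). (a, a, c)) ` ?R"
        then obtain a c where t: "t = (a, a, c)" "0 < a" "0 < c" "2 * a^2 + 4 * c^2 = n" by auto
        then show "t \<in> {t \<in> ?E. (\<lambda>(a, b, c). (b, a, c)) t = t}" using odd[OF t(4)] by simp
      qed
      moreover have "inj_on (\<lambda>(a, c). (a, a, c)) ?R" by (auto simp: inj_on_def)
      ultimately show ?thesis by (simp only: card_image)
    qed
    finally show ?thesis by (rule cong_double_mod_4)
  qed
  finally show ?thesis .
qed

text \<open>For even \<open>a\<close> the number \<open>n - a^2\<close> is twice an odd
  \<open>m\<close>, so its divisor count is 2 modulo 4 if \<open>m\<close> is a square and 0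
  otherwise.\<close>

lemma sum_divisor_count_even:
  fixes n :: nat
  assumes n: "n mod 4 = 2"
  shows "[(\<Sum>a | even a \<and> 0 < a \<and> a^2 < n. divisor_count (n - a^2)) =
    2 * card {(a, c). 0 < a \<and> 0 < c \<and> 2 * a^2 + 4 * c^2 = n}] (mod 4)"
proof -
  let ?E = "{a. even a \<and> 0 < a \<and> a^2 < n}"
  let ?R = "{(a, c). 0 < a \<and> 0 < c \<and> 2 * a^2 + 4 * c^2 = n}"
  let ?sq = "\<lambda>a. is_square ((n - a^2) div 2)"
  have le_sq: "a \<le> a^2" for a :: nat by (simp add: power2_eq_square)
  have finE: "finite ?E"
    by (rule finite_subset[of _ "{..n}"]) (auto intro: order_trans[OF le_sq])
  have "[(\<Sum>a\<in>?E. divisor_count (n - a^2)) = (\<Sum>a\<in>?E. if ?sq a then 2 else 0)] (mod 4)"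
  proof (intro cong_sum)
    fix a assume "a \<in> ?E"
    then have a: "4 dvd a^2" "a^2 < n" by (auto elim!: evenE simp: power2_eq_square)
    define m where "m = (n - a^2) div 2"
    have m: "n - a^2 = 2 * m" "odd m" using a n unfolding m_def by presburger+
    then have "divisor_count (n - a^2) = 2 * divisor_count m"
      using divisor_count_prime_mult[of 2 m] two_is_prime_nat by simp
    moreover have "even (divisor_count m) \<longleftrightarrow> \<not> is_square m"
      using m by (intro even_divisor_count_iff) (auto intro: odd_pos)
    moreover have "[2 * k = (if even k then 0 else 2)] (mod 4)" for k :: nat
      unfolding cong_def by presburger
    ultimately show "[divisor_count (n - a^2) = (if ?sq a then 2 else 0)] (mod 4)"
      unfolding m_def[symmetric] by presburger
  qed
  also have "(\<Sum>a\<in>?E. if ?sq a then 2 else 0) = 2 * card {a \<in> ?E. ?sq a}"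
    using finE by (simp add: sum.If_cases Int_def)
  \<comment> \<open>The even index of the sum is \<open>2 * c\<close>, and the first component of a
    pair in \<open>?R\<close> is the root of the square
    \<open>(n - (2 * c)^2) div 2\<close>.\<close>
  also have "card {a \<in> ?E. ?sq a} = card ?R"
  proof (rule bij_betw_same_card[symmetric], rule bij_betw_imageI)
    show "inj_on (\<lambda>(a, c). 2 * c) ?R"
      by (auto simp: inj_on_def power2_eq_iff_nonneg)
    show "(\<lambda>(a, c). 2 * c) ` ?R = {a \<in> ?E. ?sq a}"
    proof (intro equalityI subsetI)
      fix t assume "t \<in> (\<lambda>(a, c). 2 * c) ` ?R"
      then obtain a c where "t = 2 * c" "0 < a" "0 < c" "n = 2 * a^2 + 4 * c^2" by auto
      then show "t \<in> {a \<in> ?E. ?sq a}" by (auto simp: power_mult_distrib intro: is_nth_powerI)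
    next
      fix t assume t: "t \<in> {a \<in> ?E. ?sq a}"
      then obtain c where c: "t = 2 * c" by (auto elim: evenE)
      obtain a where a: "(n - t^2) div 2 = a^2" using t by (auto elim: is_nth_powerE)
      have t2: "t^2 = 4 * c^2" using c by (simp add: power_mult_distrib)
      \<comment> \<open>The inequality holds because 4 does not divide \<open>n\<close>; it rules
        out \<open>a = 0\<close>.\<close>
      then have eq: "n = 2 * a^2 + 4 * c^2" "n \<noteq> 4 * c^2" using a t n by auto presburger+
      then have "a > 0" by (cases a) auto
      then have "(a, c) \<in> ?R" using eq t c by auto
      then show "t \<in> (\<lambda>(a, c). 2 * c) ` ?R" using c by force
    qed
  qed
  finally show ?thesis .
qed

lemma sum_divisor_count_minus_square:
  fixes n :: nat
  assumes n: "n mod 4 = 2" and nsq: "\<And>a b. n \<noteq> a^2 + b^2"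
  shows "4 dvd (\<Sum>a | 0 < a \<and> a^2 < n. divisor_count (n - a^2))"
proof -
  let ?R = "{(a, c). 0 < a \<and> 0 < c \<and> 2 * a^2 + 4 * c^2 = n}"
  have "finite {a. 0 < a \<and> a^2 < n}"
    by (rule finite_subset[of _ "{..n}"]) (auto simp: power2_eq_square intro: order_trans[OF le_square])
  then have "(\<Sum>a | 0 < a \<and> a^2 < n. divisor_count (n - a^2)) =
    (\<Sum>a | odd a \<and> a^2 < n. divisor_count (n - a^2)) +
    (\<Sum>a | even a \<and> 0 < a \<and> a^2 < n. divisor_count (n - a^2))"
    by (subst sum.union_disjoint[symmetric])
      (auto intro!: sum.cong intro: odd_pos elim: finite_subset[rotated])
  moreover have "[\<dots> = 2 * card ?R + 2 * card ?R] (mod 4)"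
    by (intro cong_add sum_divisor_count_odd sum_divisor_count_even assms)
  ultimately show ?thesis by (simp add: cong_def mod_eq_0_iff_dvd)
qed

section \<open>The convolution square of the divisor count\<close>

text \<open>Pairing \<open>k\<close> with \<open>2 * N - k\<close> leaves twice the sum over
  \<open>k < N\<close> plus the square of \<open>divisor_count N\<close>, a multiple of 16. It
  remains to treat the half sum modulo 4.\<close>

lemma sum_divisor_count_convolution:
  fixes N :: nat
  assumes "odd N" and nsq: "\<And>a b. 2 * N \<noteq> a^2 + b^2" and N4: "4 dvd divisor_count N"
  shows "8 dvd (\<Sum>k\<in>{1..<2*N}. divisor_count k * divisor_count (2 * N - k))"
proof -
  let ?n = "2 * N"
  let ?d = "divisor_count"
  let ?f = "\<lambda>k. ?d k * ?d (?n - k)"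
  let ?g = "\<lambda>k. if is_square k then ?d (?n - k) else 0"
  have N: "N > 0" using assms(1) by (rule odd_pos)
  have split: "(\<Sum>k\<in>{1..<?n}. h k) = (\<Sum>k\<in>{1..<N}. h k + h (?n - k)) + h N" for h :: "nat \<Rightarrow> nat"
  proof -
    have "{1..<?n} = {1..<N} \<union> insert N {N<..<?n}" using N by auto
    then have "(\<Sum>k\<in>{1..<?n}. h k) = (\<Sum>k\<in>{1..<N}. h k) + (\<Sum>k\<in>insert N {N<..<?n}. h k)"
      by (simp only: sum.union_disjoint finite_insert finite_atLeastLessThan finite_greaterThanLessThan)
        (rule sum.union_disjoint; auto)
    moreover have "(\<Sum>k\<in>{N<..<?n}. h k) = (\<Sum>k\<in>{1..<N}. h (?n - k))"
      by (rule sum.reindex_bij_witness[of _ "\<lambda>k. ?n - k" "\<lambda>k. ?n - k"]) auto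
    ultimately show ?thesis by (simp add: sum.distrib)
  qed
  \<comment> \<open>At most one of \<open>k\<close> and \<open>2 * N - k\<close> is a square; for
    \<open>k = N\<close> this says that \<open>N\<close> is not a square.\<close>
  have notsq: "\<not> (is_square k \<and> is_square (?n - k))" if "k \<le> ?n" for k
  proof
    assume "is_square k \<and> is_square (?n - k)"
    then obtain a b where "k = a^2" "?n - k = b^2" by (auto elim!: is_nth_powerE)
    then have "?n = a^2 + b^2" using that by linarith
    then show False using nsq by blast
  qed
  have "[(\<Sum>k\<in>{1..<N}. ?f k) = (\<Sum>k\<in>{1..<N}. ?g k + ?g (?n - k))] (mod 4)"
  proof (intro cong_sum)
    fix k assume k: "k \<in> {1..<N}"
    have par: "even (?d k) \<longleftrightarrow> \<not> is_square k" "even (?d (?n - k)) \<longleftrightarrow> \<not> is_square (?n - k)"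
      using k by (auto intro!: even_divisor_count_iff)
    \<comment> \<open>An odd divisor count of a square can be replaced by 1, as the other factor is
      even.\<close>
    have *: "[x * y = y] (mod 4)" if "odd x" "even y" for x y :: nat
    proof -
      obtain i j where "x = 2 * i + 1" "y = 2 * j" using \<open>odd x\<close> \<open>even y\<close> by (metis oddE evenE)
      then have "x * y = y + 4 * (i * j)" by (simp add: algebra_simps)
      then show ?thesis by (simp add: cong_def)
    qed
    have kk: "?n - (?n - k) = k" using k by simp
    consider "is_square k" "\<not> is_square (?n - k)" | "\<not> is_square k" "is_square (?n - k)"
      | "\<not> is_square k" "\<not> is_square (?n - k)" using notsq[of k] k by auto
    then show "[?f k = ?g k + ?g (?n - k)] (mod 4)"
    proof cases
      case 1
      then show ?thesis using par *[of "?d k" "?d (?n - k)"] by simp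
    next
      case 2
      then show ?thesis using par *[of "?d (?n - k)" "?d k"] kk by (simp add: mult.commute)
    next
      case 3
      then have "2 * 2 dvd ?f k" using par by (intro mult_dvd_mono) auto
      then show ?thesis using 3 by (simp add: cong_def mod_eq_0_iff_dvd)
    qed
  qed
  \<comment> \<open>Here \<open>split\<close> is used backwards; its middle term \<open>?g N\<close>
    vanishes because \<open>N\<close> is not a square.\<close>
  also have "(\<Sum>k\<in>{1..<N}. ?g k + ?g (?n - k)) = (\<Sum>k\<in>{1..<?n}. ?g k)"
    using split[of ?g] notsq[of N] by simp
  also have "\<dots> = (\<Sum>k | k \<in> {1..<?n} \<and> is_square k. ?d (?n - k))"
    by (simp add: sum.If_cases Int_def)
  also have "\<dots> = (\<Sum>a | 0 < a \<and> a^2 < ?n. ?d (?n - a^2))"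
  proof -
    have "{k. k \<in> {1..<?n} \<and> is_square k} = (\<lambda>a. a^2) ` {a. 0 < a \<and> a^2 < ?n}"
      by (auto elim!: is_nth_powerE intro: is_nth_powerI intro!: imageI gr0I)
    moreover have "inj_on (\<lambda>a::nat. a^2) {a. 0 < a \<and> a^2 < ?n}"
      by (auto simp: inj_on_def power2_eq_iff_nonneg)
    ultimately show ?thesis by (simp add: sum.reindex)
  qed
  finally have "[(\<Sum>k\<in>{1..<N}. ?f k) = (\<Sum>a | 0 < a \<and> a^2 < ?n. ?d (?n - a^2))] (mod 4)" .
  moreover have "?n mod 4 = 2" using assms(1) by presburger
  then have "4 dvd (\<Sum>a | 0 < a \<and> a^2 < ?n. ?d (?n - a^2))"
    using nsq by (rule sum_divisor_count_minus_square)
  ultimately have "4 dvd (\<Sum>k\<in>{1..<N}. ?f k)" by (simp only: cong_dvd_iff)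
  then have "2 * 4 dvd 2 * (\<Sum>k\<in>{1..<N}. ?f k)" by (rule mult_dvd_mono[OF dvd_refl])
  moreover have "(\<Sum>k\<in>{1..<N}. ?f k + ?f (?n - k)) = 2 * (\<Sum>k\<in>{1..<N}. ?f k)"
    unfolding sum_distrib_left by (intro sum.cong) (auto simp: mult.commute)
  moreover have "8 dvd ?f N"
    using mult_dvd_mono[OF N4 N4] by (auto intro: dvd_trans[of 8 16])
  ultimately show ?thesis using split[of ?f] by auto
qed

section \<open>Partitions with two part sizes\<close>

text \<open>\<open>a\<close> and \<open>b\<close> are the larger and the smaller part,
  \<open>x\<close> and \<open>y\<close> their multiplicities; the order \<open>b < a\<close> makes
  the quadruple unique.\<close>

lemma nu_2_eq_card:
  "nu 2 m = card {(a, x, b, y). 0 < b \<and> b < a \<and> 0 < x \<and> 0 < y \<and> a * x + b * y = m}"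
proof -
  let ?Q = "{(a, x, b, y). 0 < b \<and> b < a \<and> 0 < x \<and> 0 < y \<and> a * x + b * y = m}"
  let ?f = "\<lambda>(a, x, b, y). replicate_mset x a + replicate_mset y (b::nat)"
  have inj: "inj_on ?f ?Q"
  proof (rule inj_onI)
    fix s t assume st: "s \<in> ?Q" "t \<in> ?Q" "?f s = ?f t"
    obtain a x b y where s: "s = (a, x, b, y)" by (cases s)
    obtain a' x' b' y' where t: "t = (a', x', b', y')" by (cases t)
    have pos: "0 < b" "b < a" "0 < x" "0 < y" "0 < b'" "b' < a'" "0 < x'" "0 < y'"
      and eq: "replicate_mset x a + replicate_mset y b = replicate_mset x' a' + replicate_mset y' b'"
      using st by (simp_all add: s t)
    have "{a, b} = {a', b'}" using arg_cong[OF eq, of set_mset] pos by auto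
    then have ab: "a = a'" "b = b'" using pos by (auto simp: doubleton_eq_iff)
    have "x = x'" using arg_cong[OF eq, of "\<lambda>P. count P a"] pos ab by simp
    moreover have "y = y'" using arg_cong[OF eq, of "\<lambda>P. count P b"] pos ab by simp
    ultimately show "s = t" using ab by (simp add: s t)
  qed
  have img: "?f ` ?Q = {P \<in> partitions m. card (set_mset P) = 2}"
  proof (intro equalityI subsetI)
    fix P assume "P \<in> ?f ` ?Q"
    then obtain a x b y where "0 < b" "b < a" "0 < x" "0 < y" "a * x + b * y = m"
      "P = replicate_mset x a + replicate_mset y b" by auto
    then show "P \<in> {P \<in> partitions m. card (set_mset P) = 2}"
      by (auto simp: partitions_def mult.commute)
  next
    fix P assume "P \<in> {P \<in> partitions m. card (set_mset P) = 2}"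
    then have P: "0 \<notin># P" "sum_mset P = m" "card (set_mset P) = 2"
      by (auto simp: partitions_def)
    from P(3) obtain u v where uv: "set_mset P = {u, v}" "u \<noteq> v"
      by (auto simp: card_2_iff)
    then obtain a b where ab: "set_mset P = {a, b}" "b < a"
      by (metis insert_commute linorder_neqE_nat)
    have eq: "P = replicate_mset (count P a) a + replicate_mset (count P b) b"
      using ab by (intro multiset_eqI) (auto simp: count_eq_zero_iff)
    have "sum_mset P = count P a * a + count P b * b"
      by (subst eq) (simp add: sum_mset_replicate_mset)
    moreover have "0 < count P a" "0 < count P b" using ab by auto
    moreover have "0 < b" using P(1) ab by (cases b) auto
    ultimately have "(a, count P a, b, count P b) \<in> ?Q" using P ab by (simp add: mult.commute)
    moreover have "P = ?f (a, count P a, b, count P b)" unfolding prod.case by (rule eq)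
    ultimately show "P \<in> ?f ` ?Q" by (rule rev_image_eqI)
  qed
  show ?thesis unfolding nu_def img[symmetric] by (rule card_image[OF inj])
qed

text \<open>All positive solutions of \<open>a * x + b * y = n\<close> are counted twice: by the
  value of \<open>a * x\<close>, and by the order of \<open>a\<close> and \<open>b\<close>. The form
  with two sums avoids subtraction of natural numbers.\<close>

lemma nu_2_divisor_count:
  "2 * nu 2 n + divisor_sum n =
    (\<Sum>k\<in>{1..<n}. divisor_count k * divisor_count (n - k)) + divisor_count n"
  if "n > 0"
proof -
  let ?A = "{(a, x, b, y). 0 < a \<and> 0 < b \<and> 0 < x \<and> 0 < y \<and> a * x + b * y = n}"
  let ?G = "{(a, x, b, y). 0 < b \<and> b < a \<and> 0 < x \<and> 0 < y \<and> a * x + b * y = n}"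
  let ?L = "{(a, x, b, y). 0 < a \<and> a < b \<and> 0 < x \<and> 0 < y \<and> a * x + b * y = n}"
  let ?D = "{(a, x, b, y). 0 < a \<and> a = b \<and> 0 < x \<and> 0 < y \<and> a * x + b * y = n}"
  have finA: "finite ?A"
  proof (rule finite_subset)
    show "?A \<subseteq> {..n} \<times> {..n} \<times> {..n} \<times> {..n}"
    proof clarsimp
      fix a x b y :: nat assume "0 < a" "0 < b" "0 < x" "0 < y"
      then have "a \<le> a * x" "x \<le> a * x" "b \<le> b * y" "y \<le> b * y" by auto
      then show "a \<le> a * x + b * y \<and> x \<le> a * x + b * y \<and> b \<le> a * x + b * y \<and> y \<le> a * x + b * y"
        by linarith
    qed
  qed auto
  have "?A = ?G \<union> ?L \<union> ?D" by auto
  moreover have fin: "finite ?G" "finite ?L" "finite ?D" by (auto intro: finite_subset[OF _ finA])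
  moreover have "card (?G \<union> ?L \<union> ?D) = card ?G + card ?L + card ?D"
  proof -
    have "card (?G \<union> ?L \<union> ?D) = card (?G \<union> ?L) + card ?D"
      by (rule card_Un_disjoint) (use fin in auto)
    also have "card (?G \<union> ?L) = card ?G + card ?L"
      by (rule card_Un_disjoint) (use fin in auto)
    finally show ?thesis .
  qed
  moreover have "card ?G = card ?L"
  proof (rule bij_betw_same_card)
    show "bij_betw (\<lambda>(a, x, b, y). (b, y, a, x)) ?G ?L"
      by (rule bij_betw_byWitness[where f' = "\<lambda>(a, x, b, y). (b, y, a, x)"])
        (auto simp: add.commute)
  qed
  ultimately have A: "card ?A = 2 * nu 2 n + card ?D" by (simp add: nu_2_eq_card)
  \<comment> \<open>If \<open>a = b\<close>, then \<open>d = x + y\<close> is a divisor of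
    \<open>n\<close> with \<open>a = n div d\<close>, and \<open>x\<close> takes the
    \<open>d - 1\<close> values from 1 to \<open>d - 1\<close>.\<close>
  have "card ?D + divisor_count n = divisor_sum n"
  proof -
    have "bij_betw (\<lambda>(d, x). (n div d, x, n div d, d - x)) (SIGMA d:{d. d dvd n}. {1..<d}) ?D"
    proof (rule bij_betw_byWitness[where f' = "\<lambda>(a, x, b, y). (x + y, x)"])
      have *: "n div d * x + n div d * (d - x) = n" if "d dvd n" "x < d" for d x
        using that by (simp flip: distrib_left)
      show "(\<lambda>(d, x). (n div d, x, n div d, d - x)) ` (SIGMA d:{d. d dvd n}. {1..<d}) \<subseteq> ?D"
        using that * by (auto simp: dvd_div_eq_0_iff)
      show "(\<lambda>(a, x, b, y). (x + y, x)) ` ?D \<subseteq> (SIGMA d:{d. d dvd n}. {1..<d})"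
        by (auto simp flip: distrib_left)
      show "\<forall>t\<in>?D. (\<lambda>(d, x). (n div d, x, n div d, d - x)) ((\<lambda>(a, x, b, y). (x + y, x)) t) = t"
        by (auto simp flip: distrib_left)
    qed auto
    then have "card ?D = card (SIGMA d:{d. d dvd n}. {1..<d})" by (rule bij_betw_same_card[symmetric])
    also have "\<dots> = (\<Sum>d | d dvd n. d - 1)" using that by (subst card_SigmaI) auto
    also have "\<dots> + divisor_count n = (\<Sum>d | d dvd n. d - 1 + 1)"
      unfolding divisor_count_def sum.distrib by simp
    also have "\<dots> = divisor_sum n"
      unfolding divisor_sum_def using that by (intro sum.cong) (auto intro: dvd_pos_nat)
    finally show ?thesis .
  qed
  moreover have "card ?A = (\<Sum>k\<in>{1..<n}. divisor_count k * divisor_count (n - k))"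
  proof -
    \<comment> \<open>With \<open>k = a * x\<close>, the factor \<open>a\<close> is any divisor of
      \<open>k\<close> and \<open>b\<close> any divisor of \<open>n - k\<close>.\<close>
    let ?S = "SIGMA k:{1..<n}. {d. d dvd k} \<times> {d. d dvd (n - k)}"
    have "bij_betw (\<lambda>(k, a, b). (a, k div a, b, (n - k) div b)) ?S ?A"
    proof (rule bij_betw_byWitness[where f' = "\<lambda>(a, x, b, y). (a * x, a, b)"])
      have pos: "0 < d \<and> 0 < k div d" if "d dvd k" "0 < k" for d k :: nat
        using that by (auto elim!: dvdE)
      show "(\<lambda>(k, a, b). (a, k div a, b, (n - k) div b)) ` ?S \<subseteq> ?A"
      proof clarify
        fix k a b assume "k \<in> {1..<n}" "a dvd k" "b dvd n - k"
        then show "0 < a \<and> 0 < b \<and> 0 < k div a \<and> 0 < (n - k) div b \<and>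
          a * (k div a) + b * ((n - k) div b) = n"
          using pos[of a k] pos[of b "n - k"] by simp
      qed
      show "(\<lambda>(a, x, b, y). (a * x, a, b)) ` ?A \<subseteq> ?S" by auto
    qed auto
    then have "card ?A = card ?S" by (rule bij_betw_same_card[symmetric])
    also have "\<dots> = (\<Sum>k\<in>{1..<n}. card ({d. d dvd k} \<times> {d. d dvd (n - k)}))"
      by (rule card_SigmaI) auto
    finally show ?thesis by (simp add: card_cartesian_product divisor_count_def)
  qed
  ultimately show ?thesis using A by linarith
qed

section \<open>The congruences\<close>

text \<open>Otherwise \<open>q\<close> divides neither number, and raising the congruence of
  \<open>a^2\<close> and \<open>-(b^2)\<close> to the power \<open>(q - 1) / 2\<close>, which is
  odd, gives 1 = -1 modulo \<open>q\<close> by Fermat's theorem.\<close>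

lemma prime_3_mod_4_dvd_sum_squares:
  fixes q a b :: nat
  assumes q: "prime q" "q mod 4 = 3" and dvd: "q dvd a^2 + b^2"
  shows "q dvd a"
proof (rule ccontr)
  assume a: "\<not> q dvd a"
  have b: "\<not> q dvd b"
  proof
    assume "q dvd b"
    then have "q dvd a^2" using dvd by (simp add: dvd_add_left_iff power2_eq_square)
    then show False using a q(1) prime_dvd_power by blast
  qed
  obtain j where j: "q = 4 * j + 3" using q(2) by (metis mult_div_mod_eq)
  have fermat: "[int c ^ (q - 1) = 1] (mod int q)" if "\<not> q dvd c" for c
    using fermat_theorem[OF q(1) that] by (metis cong_int_iff of_nat_1 of_nat_power)
  have exp: "q - 1 = 2 * (2 * j + 1)" using j by simp
  have "int q dvd (int a)^2 + (int b)^2" using dvd by (metis int_dvd_int_iff of_nat_add of_nat_power)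
  then have "[(int a)^2 = - ((int b)^2)] (mod int q)" by (simp add: cong_iff_dvd_diff)
  then have "[((int a)^2) ^ (2 * j + 1) = (- ((int b)^2)) ^ (2 * j + 1)] (mod int q)"
    by (rule cong_pow)
  moreover have "(- ((int b)^2)) ^ (2 * j + 1) = - (int b ^ (q - 1))"
    unfolding exp power_mult by (rule power_minus_odd) simp
  moreover have "((int a)^2) ^ (2 * j + 1) = int a ^ (q - 1)"
    unfolding exp power_mult ..
  ultimately have "[int a ^ (q - 1) = - (int b ^ (q - 1))] (mod int q)" by simp
  then have "[1 = - 1] (mod int q)"
    using fermat[OF a] fermat[OF b] by (meson cong_minus_minus_iff cong_sym cong_trans)
  then have "int q dvd 2" by (simp add: cong_iff_dvd_diff)
  then have "q \<le> 2" by (auto dest: zdvd_imp_le)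
  then show False using j by simp
qed

text \<open>In the divisor count the factors 2, \<open>q\<close> and \<open>M\<close> each
  contribute a factor 2. In the divisor sum \<open>q\<close> contributes \<open>q + 1\<close>, a
  multiple of 4, and \<open>M\<close> an even number.\<close>

lemma nu_2_cong_0_mod_4:
  fixes q M :: nat
  assumes q: "prime q" "q mod 4 = 3" "\<not> q dvd M" and M: "odd M" "\<not> is_square M"
  shows "[nu 2 (2 * (q * M)) = 0] (mod 4)"
proof -
  have qodd: "odd q" using q(2) by presburger
  have pos: "M > 0" "q > 0" using M q(1) by (auto intro: odd_pos simp: prime_gt_0_nat)
  have dM: "even (divisor_count M)" "even (divisor_sum M)"
    using even_divisor_count_iff[OF pos(1)] even_divisor_sum M by auto
  have "4 dvd q + 1" using q(2) by presburger
  have two: "prime (2::nat)" "\<not> 2 dvd q * M" using qodd M by auto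
  have count_N: "divisor_count (q * M) = 2 * divisor_count M"
    by (rule divisor_count_prime_mult[OF q(1,3)])
  have count: "8 dvd divisor_count (2 * (q * M))"
    using dM by (auto simp: divisor_count_prime_mult[OF two] count_N)
  have "4 * 2 dvd (q + 1) * divisor_sum M" using \<open>4 dvd q + 1\<close> dM(2) by (rule mult_dvd_mono)
  then have "4 * 2 dvd divisor_sum (2 * (q * M))"
    unfolding divisor_sum_prime_mult[OF two] divisor_sum_prime_mult[OF q(1,3)]
    by (rule dvd_mult)
  then have sum: "8 dvd divisor_sum (2 * (q * M))" by simp
  have conv: "8 dvd (\<Sum>k\<in>{1..<2*(q*M)}. divisor_count k * divisor_count (2 * (q * M) - k))"
  proof (rule sum_divisor_count_convolution)
    show "odd (q * M)" using qodd M by simp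
    show "4 dvd divisor_count (q * M)" using dM by (auto simp: count_N)
    show "2 * (q * M) \<noteq> a^2 + b^2" for a b
    proof
      \<comment> \<open>\<open>q\<close> would divide \<open>a\<close> and \<open>b\<close>, so its
        square would divide \<open>2 * (q * M)\<close>, although \<open>q\<close> is odd and does
        not divide \<open>M\<close>.\<close>
      assume eq: "2 * (q * M) = a^2 + b^2"
      then have "q dvd a^2 + b^2" by (metis dvd_mult dvd_triv_left)
      then have "q dvd a" "q dvd b"
        using prime_3_mod_4_dvd_sum_squares[OF q(1,2), of a b]
          prime_3_mod_4_dvd_sum_squares[OF q(1,2), of b a] by (simp_all only: add.commute)
      then have "q * q dvd a^2 + b^2" unfolding power2_eq_square by (intro dvd_add mult_dvd_mono)
      then have "q * q dvd q * (2 * M)" by (simp flip: eq add: ac_simps)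
      then have "q dvd 2 * M" using pos by simp
      then have "q dvd 2" using q(1,3) by (simp add: prime_dvd_mult_iff)
      then show False using q(2) by (auto dest!: dvd_imp_le simp: le_Suc_eq numeral_2_eq_2)
    qed
  qed
  have "2 * nu 2 (2 * (q * M)) + divisor_sum (2 * (q * M)) =
    (\<Sum>k\<in>{1..<2*(q*M)}. divisor_count k * divisor_count (2 * (q * M) - k)) +
    divisor_count (2 * (q * M))"
    by (rule nu_2_divisor_count) (use pos in simp)
  then have "8 dvd 2 * nu 2 (2 * (q * M)) + divisor_sum (2 * (q * M))" using conv count by simp
  then have "8 dvd 2 * nu 2 (2 * (q * M))" using sum by (simp add: dvd_add_left_iff)
  then have "4 dvd nu 2 (2 * (q * M))" by presburger
  then show ?thesis by (simp add: cong_0_iff)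
qed

text \<open>The residues are those of the cofactors \<open>6 * n + 5\<close> modulo 3,
  \<open>12 * n + 7\<close> modulo 4, and \<open>14 * n + 5\<close> and \<open>42 * n + 19\<close>
  modulo 7.\<close>

lemma
  fixes M :: nat
  shows not_square_mod_3: "M mod 3 = 2 \<Longrightarrow> \<not> is_square M"
    and not_square_mod_4: "M mod 4 = 3 \<Longrightarrow> \<not> is_square M"
    and not_square_mod_7: "M mod 7 = 5 \<Longrightarrow> \<not> is_square M"
proof -
  have sq_3: "a^2 mod 3 \<noteq> 2" for a :: nat
  proof -
    have "a mod 3 \<in> {0,1,2}" by auto
    then have "(a mod 3)^2 mod 3 \<noteq> 2" by (elim insertE emptyE) simp_all
    then show ?thesis by (simp add: power_mod)
  qed
  have sq_4: "a^2 mod 4 \<noteq> 3" for a :: nat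
  proof -
    have "a mod 4 \<in> {0,1,2,3}" by auto
    then have "(a mod 4)^2 mod 4 \<noteq> 3" by (elim insertE emptyE) simp_all
    then show ?thesis by (simp add: power_mod)
  qed
  have sq_7: "a^2 mod 7 \<noteq> 5" for a :: nat
  proof -
    have "a mod 7 \<in> {0,1,2,3,4,5,6}" by auto
    then have "(a mod 7)^2 mod 7 \<noteq> 5" by (elim insertE emptyE) simp_all
    then show ?thesis by (simp add: power_mod)
  qed
  show "M mod 3 = 2 \<Longrightarrow> \<not> is_square M" "M mod 4 = 3 \<Longrightarrow> \<not> is_square M"
    "M mod 7 = 5 \<Longrightarrow> \<not> is_square M"
    using sq_3 sq_4 sq_7 by (auto elim!: is_nth_powerE)
qed

theorem theorem1:
  fixes A B n :: nat
  assumes "(A, B) \<in> {(36, 30), (72, 42), (196, 70), (252, 114)}"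
  shows "[nu 2 (A * n + B) = 0] (mod 4)"
proof -
  have primes: "prime (3::nat)" "prime (7::nat)" by simp_all
  consider "A = 36" "B = 30" | "A = 72" "B = 42" | "A = 196" "B = 70" | "A = 252" "B = 114"
    using assms by auto
  then show ?thesis
  proof cases
    case 1
    have "\<not> is_square (6 * n + 5)" by (rule not_square_mod_3) presburger
    moreover have "\<not> 3 dvd 6 * n + 5" "odd (6 * n + 5)" by presburger+
    ultimately have "[nu 2 (2 * (3 * (6 * n + 5))) = 0] (mod 4)"
      using primes by (intro nu_2_cong_0_mod_4) simp_all
    moreover have "2 * (3 * (6 * n + 5)) = A * n + B" using 1 by simp
    ultimately show ?thesis by (simp only:)
  next
    case 2
    have "\<not> is_square (12 * n + 7)" by (rule not_square_mod_4) presburger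
    moreover have "\<not> 3 dvd 12 * n + 7" "odd (12 * n + 7)" by presburger+
    ultimately have "[nu 2 (2 * (3 * (12 * n + 7))) = 0] (mod 4)"
      using primes by (intro nu_2_cong_0_mod_4) simp_all
    moreover have "2 * (3 * (12 * n + 7)) = A * n + B" using 2 by simp
    ultimately show ?thesis by (simp only:)
  next
    case 3
    have "\<not> is_square (14 * n + 5)" by (rule not_square_mod_7) presburger
    moreover have "\<not> 7 dvd 14 * n + 5" "odd (14 * n + 5)" by presburger+
    ultimately have "[nu 2 (2 * (7 * (14 * n + 5))) = 0] (mod 4)"
      using primes by (intro nu_2_cong_0_mod_4) simp_all
    moreover have "2 * (7 * (14 * n + 5)) = A * n + B" using 3 by simp
    ultimately show ?thesis by (simp only:)
  next
    case 4
    \<comment> \<open>The modulus 7 decides here although \<open>q\<close> is 3: the cofactor is 1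
      modulo 3, and modulo 4 it is 3 or 1 depending on \<open>n\<close>.\<close>
    have "\<not> is_square (42 * n + 19)" by (rule not_square_mod_7) presburger
    moreover have "\<not> 3 dvd 42 * n + 19" "odd (42 * n + 19)" by presburger+
    ultimately have "[nu 2 (2 * (3 * (42 * n + 19))) = 0] (mod 4)"
      using primes by (intro nu_2_cong_0_mod_4) simp_all
    moreover have "2 * (3 * (42 * n + 19)) = A * n + B" using 4 by simp
    ultimately show ?thesis by (simp only:)
  qed
qed

end
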